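(* Let $b(x;y)$ be a biquadratic form in $x=(x_1,\dots,x_n)^T$ and $y=(y_1,\dots,y_n)^T$. Define the $n\times n$ polynomial matrix $C(x,y)$ by $$[C(x,y)]_{ij}:=\frac{\partial^2 b(x;y)}{\partial x_i\,\partial y_j},$$ and let $\gamma$ be the largest coefficient, in absolute value, of any monomial present in some entry of the matrix $C(x,y)$ (with $\gamma=0$ if $C(x,y)=0$). Let $f$ be the form given by $$f(x,y):=b(x;y)+\frac{n^2\gamma}{2}\Big(\sum_{i=1}^n x_i^4+\sum_{i=1}^n y_i^4+\sum_{\substack{i,j=1,\ldots,n\\ i<j}}x_i^2x_j^2+\sum_{\substack{i,j=1,\ldots,n\\ i<j}}y_i^2y_j^2\Big).$$ Then $b(x;y)\ge 0$ for all $x,y\in\mathbb{R}^n$ if and only if $f$ is convex as a function on $\mathbb{R}^{2n}$.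
   Context: A biquadratic form $b(x;y)$ in the variables $x=(x_1,\dots,x_n)^T$ and $y=(y_1,\dots,y_m)^T$ is a form (homogeneous polynomial) with real coefficients that can be written as $b(x;y)=\sum_{i\le j,\ k\le l}\alpha_{ijkl}\,x_ix_jy_ky_l$. Here $m=n$. The quantity $\gamma\geq 0$ is the maximum of the absolute values of the coefficients. *)

theory Defs
  imports "HOL-Analysis.Analysis" "HOL-Library.Poly_Mapping"
begin

text \<open>
  Real multivariate polynomials with indeterminates indexed by \<open>'v\<close>: finitely supported
  maps from monomials (exponent maps \<open>'v \<Rightarrow>\<^sub>0 nat\<close>) to coefficients. The ring
  operations are those of \<^theory>\<open>HOL-Library.Poly_Mapping\<close> (convolution product).
\<close>

type_synonym 'v rpoly = "('v \<Rightarrow>\<^sub>0 nat) \<Rightarrow>\<^sub>0 real"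

definition Const :: "real \<Rightarrow> 'v rpoly" where
  "Const c = Poly_Mapping.single 0 c"

definition Var :: "'v \<Rightarrow> 'v rpoly" where
  "Var v = Poly_Mapping.single (Poly_Mapping.single v 1) 1"

definition eval_rpoly :: "('v \<Rightarrow> real) \<Rightarrow> 'v rpoly \<Rightarrow> real" where
  "eval_rpoly a p =
     (\<Sum>m\<in>Poly_Mapping.keys p. Poly_Mapping.lookup p m *
        (\<Prod>v\<in>Poly_Mapping.keys m. a v ^ Poly_Mapping.lookup m v))"

text \<open>
  Formal partial derivative. When \<open>v\<close> does not occur in \<open>m\<close>, the truncated subtraction
  leaves \<open>m\<close> unchanged, but the coefficient of that summand is \<open>0\<close>.
\<close>

definition partial_deriv :: "'v \<Rightarrow> 'v rpoly \<Rightarrow> 'v rpoly" where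
  "partial_deriv v p =
     (\<Sum>m\<in>Poly_Mapping.keys p.
        Poly_Mapping.single (m - Poly_Mapping.single v 1)
          (Poly_Mapping.lookup p m * real (Poly_Mapping.lookup m v)))"

text \<open>
  The variables \<open>x\<^sub>i\<close> are indexed by \<open>Inl i\<close> and the variables \<open>y\<^sub>j\<close> by \<open>Inr j\<close>.
  The linear order on the index types only serves to write sums over \<open>i \<le> j\<close> and \<open>i < j\<close>.
\<close>

abbreviation X :: "'n \<Rightarrow> ('n + 'm) rpoly" where
  "X i \<equiv> Var (Inl i)"

abbreviation Y :: "'m \<Rightarrow> ('n + 'm) rpoly" where
  "Y j \<equiv> Var (Inr j)"

definition eval_xy :: "('n + 'm) rpoly \<Rightarrow> real ^ 'n \<Rightarrow> real ^ 'm \<Rightarrow> real" where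
  "eval_xy p x y = eval_rpoly (case_sum (\<lambda>i. x $ i) (\<lambda>j. y $ j)) p"

definition biquadratic_form ::
    "('n :: {finite, linorder} + 'm :: {finite, linorder}) rpoly \<Rightarrow> bool" where
  "biquadratic_form b \<longleftrightarrow>
     (\<exists>\<alpha> :: 'n \<Rightarrow> 'n \<Rightarrow> 'm \<Rightarrow> 'm \<Rightarrow> real.
        b = (\<Sum>(i, j) \<in> {(i, j). i \<le> j}. \<Sum>(k, l) \<in> {(k, l). k \<le> l}.
               Const (\<alpha> i j k l) * X i * X j * Y k * Y l))"

definition mixed_hessian :: "('n + 'm) rpoly \<Rightarrow> (('n + 'm) rpoly) ^ 'm ^ 'n" where
  "mixed_hessian b = (\<chi> i j. partial_deriv (Inl i) (partial_deriv (Inr j) b))"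

definition max_abs_coeff :: "(('v rpoly) ^ 'm) ^ 'n \<Rightarrow> real" where
  "max_abs_coeff C =
     (if C = 0 then 0
      else Max {\<bar>Poly_Mapping.lookup (C $ i $ j) m\<bar> | i j m. m \<in> Poly_Mapping.keys (C $ i $ j)})"

end

theory Submission
  imports Defs
begin

text \<open>
  Let \<open>q(x) = \<Sum>\<^sub>i x\<^sub>i\<^sup>4 + \<Sum>\<^sub>i\<^sub><\<^sub>j x\<^sub>i\<^sup>2 x\<^sub>j\<^sup>2\<close> and
  \<open>K = n\<^sup>2\<gamma>/2\<close>, so that \<open>f(x,y) = b(x;y) + K(q(x) + q(y))\<close>.

  Nonnegativity gives convexity by a look at the second derivative of \<open>f\<close> in a direction
  \<open>(u,v)\<close>. Since \<open>b\<close> is quadratic in each group of variables, the contribution of \<open>b\<close> is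
  \<open>2b(u;y) + 2b(x;v) + 2 u\<^sup>T C(x,y) v\<close>. The first two terms are twice values of \<open>b\<close>,
  hence nonnegative; only the cross term can be negative, and the quartic part of \<open>f\<close> is
  chosen to dominate it. Each coefficient in \<open>C\<close> is at most \<open>\<gamma>\<close> in absolute value, so
  \<open>|u\<^sup>T C(x,y) v|\<close> is at most \<open>\<gamma>\<close> times the product of the \<open>\<ell>\<^sub>1\<close>-norms of \<open>u, x, v, y\<close>;
  by the AM-GM and Cauchy-Schwarz inequalities, twice this is at most
  \<open>n\<^sup>2\<gamma>(|x|\<^sup>2|u|\<^sup>2 + |y|\<^sup>2|v|\<^sup>2)\<close> (\<open>double_biquad_cross_bound\<close>). On the other side,
  \<open>q(x) = (\<Sum>\<^sub>i x\<^sub>i\<^sup>4 + |x|\<^sup>4)/2\<close> has second derivative at least \<open>2|x|\<^sup>2|u|\<^sup>2\<close> in the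
  direction \<open>u\<close> (\<open>quartic_line_derivs\<close>), so \<open>K\<close> times the two quartic contributions is at
  least the same bound.

  Convexity gives nonnegativity because the quartic part in \<open>y\<close> vanishes to fourth order at
  \<open>y = 0\<close>, whereas \<open>b\<close> is quadratic there. The midpoint inequality for
  \<open>(x, ty)\<close> and \<open>(x, -ty)\<close> reads \<open>0 \<le> t\<^sup>2 b(x;y) + t\<^sup>4 K q(y)\<close>; divide by \<open>t\<^sup>2\<close> and let
  \<open>t\<close> tend to \<open>0\<close> (\<open>convex_imp_biquad_nonneg\<close>).

  Since \<open>\<gamma>\<close> is read off a matrix of formal polynomials, a link between
  the coefficients of \<open>C\<close> and those of \<open>b\<close> is also required: the coefficient of
  \<open>x\<^sub>j y\<^sub>l\<close> in \<open>C\<^sub>i\<^sub>k\<close> is the coefficient of \<open>x\<^sub>i x\<^sub>j y\<^sub>k y\<^sub>l\<close> in \<open>b\<close>, doubled if \<open>i = j\<close> and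
  doubled again if \<open>k = l\<close> (\<open>mixed_hessian_coeff_bound\<close>).
\<close>

section \<open>Evaluation of polynomials\<close>

definition monom_value :: "('v \<Rightarrow> real) \<Rightarrow> ('v \<Rightarrow>\<^sub>0 nat) \<Rightarrow> real" where
  "monom_value a m = (\<Prod>v\<in>Poly_Mapping.keys m. a v ^ Poly_Mapping.lookup m v)"

text \<open>
  Enlarging the index set beyond the variables that occur makes two monomials comparable
  over one common index set; \<open>eval_rpoly_superset\<close> does the same for polynomials.
\<close>

lemma monom_value_superset:
  assumes "finite S" "Poly_Mapping.keys m \<subseteq> S"
  shows "monom_value a m = (\<Prod>v\<in>S. a v ^ Poly_Mapping.lookup m v)"
  unfolding monom_value_def using assms
  by (intro prod.mono_neutral_left) (auto simp: in_keys_iff)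

lemma monom_value_add: "monom_value a (m + n) = monom_value a m * monom_value a n"
proof -
  let ?S = "Poly_Mapping.keys m \<union> Poly_Mapping.keys n"
  have "monom_value a (m + n) = (\<Prod>v\<in>?S. a v ^ Poly_Mapping.lookup (m + n) v)"
    by (rule monom_value_superset) (simp_all add: Poly_Mapping.keys_add)
  also have "\<dots> = monom_value a m * monom_value a n"
    by (simp add: lookup_add power_add prod.distrib monom_value_superset[of ?S])
  finally show ?thesis .
qed

lemma eval_rpoly_superset:
  assumes "finite S" "Poly_Mapping.keys p \<subseteq> S"
  shows "eval_rpoly a p = (\<Sum>m\<in>S. Poly_Mapping.lookup p m * monom_value a m)"
  unfolding eval_rpoly_def monom_value_def[symmetric] using assms
  by (intro sum.mono_neutral_left) (auto simp: in_keys_iff)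

lemma eval_rpoly_add: "eval_rpoly a (p + q) = eval_rpoly a p + eval_rpoly a q"
proof -
  let ?S = "Poly_Mapping.keys p \<union> Poly_Mapping.keys q"
  have "eval_rpoly a (p + q) = (\<Sum>m\<in>?S. Poly_Mapping.lookup (p + q) m * monom_value a m)"
    by (rule eval_rpoly_superset) (simp_all add: Poly_Mapping.keys_add)
  also have "\<dots> = eval_rpoly a p + eval_rpoly a q"
    by (simp add: lookup_add distrib_right sum.distrib eval_rpoly_superset[of ?S])
  finally show ?thesis .
qed

lemma eval_rpoly_0: "eval_rpoly a 0 = 0"
  by (simp add: eval_rpoly_def)

lemma eval_rpoly_sum: "eval_rpoly a (\<Sum>i\<in>I. p i) = (\<Sum>i\<in>I. eval_rpoly a (p i))"
  by (induction I rule: infinite_finite_induct) (auto simp: eval_rpoly_0 eval_rpoly_add)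

lemma eval_rpoly_single: "eval_rpoly a (Poly_Mapping.single m c) = c * monom_value a m"
  by (simp add: eval_rpoly_superset[of "{m}"])

lemma sum_of_monomials:
  fixes p :: "'v rpoly"
  shows "p = (\<Sum>m\<in>Poly_Mapping.keys p. Poly_Mapping.single m (Poly_Mapping.lookup p m))"
  by (rule poly_mapping_eqI) (auto simp: lookup_sum lookup_single when_def in_keys_iff)

text \<open>
  Evaluation is additive and multiplicative on monomials, so the product rule follows by
  writing both factors as sums of monomials.
\<close>

lemma eval_rpoly_mult: "eval_rpoly a (p * q) = eval_rpoly a p * eval_rpoly a q"
proof -
  have "eval_rpoly a (p * q) =
      eval_rpoly a ((\<Sum>m\<in>Poly_Mapping.keys p. Poly_Mapping.single m (Poly_Mapping.lookup p m)) *
                    (\<Sum>m\<in>Poly_Mapping.keys q. Poly_Mapping.single m (Poly_Mapping.lookup q m)))"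
    using sum_of_monomials[of p] sum_of_monomials[of q] by simp
  also have "\<dots> = (\<Sum>m\<in>Poly_Mapping.keys p. Poly_Mapping.lookup p m * monom_value a m) *
                 (\<Sum>m\<in>Poly_Mapping.keys q. Poly_Mapping.lookup q m * monom_value a m)"
    by (simp add: sum_product mult_single eval_rpoly_sum eval_rpoly_single monom_value_add mult_ac)
  finally show ?thesis by (simp add: eval_rpoly_superset[OF finite_keys subset_refl])
qed

lemma eval_rpoly_Const: "eval_rpoly a (Const c) = c"
  by (simp add: Const_def eval_rpoly_single monom_value_def)

lemma eval_rpoly_Var: "eval_rpoly a (Var v) = a v"
  by (simp add: Var_def eval_rpoly_single monom_value_def)

lemma eval_rpoly_power: "eval_rpoly a (p ^ n) = eval_rpoly a p ^ n"
proof (induction n)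
  case 0
  have "(1 :: 'a rpoly) = Const 1" by (simp add: Const_def)
  then show ?case by (metis eval_rpoly_Const power_0)
qed (simp add: eval_rpoly_mult)

lemmas eval_rpoly_hom =
  eval_rpoly_add eval_rpoly_sum eval_rpoly_mult eval_rpoly_power eval_rpoly_Const eval_rpoly_Var

section \<open>Coefficients of the mixed Hessian\<close>

text \<open>
  Only the monomial \<open>m v\<close> can differentiate to \<open>m\<close>. Because the subtraction of exponents is
  truncated, \<open>m\<close> itself may also be sent to \<open>m\<close>, but then \<open>v\<close> does not occur in it
  and its coefficient is \<open>0\<close>.
\<close>

lemma lookup_partial_deriv:
  "Poly_Mapping.lookup (partial_deriv v p) m =
     Poly_Mapping.lookup p (m + Poly_Mapping.single v 1) * real (Poly_Mapping.lookup m v + 1)"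
proof -
  let ?e = "Poly_Mapping.single v (1 :: nat)"
  have summand: "Poly_Mapping.lookup (Poly_Mapping.single (n - ?e)
            (Poly_Mapping.lookup p n * real (Poly_Mapping.lookup n v))) m =
        (if n = m + ?e then Poly_Mapping.lookup p (m + ?e) * real (Poly_Mapping.lookup m v + 1)
         else 0)" for n
  proof (cases "n = m + ?e")
    case True
    then show ?thesis by (simp add: lookup_add)
  next
    case False
    have "Poly_Mapping.lookup n v = 0" if "n - ?e = m"
    proof (rule ccontr)
      assume "Poly_Mapping.lookup n v \<noteq> 0"
      then have "n = n - ?e + ?e"
        by (intro poly_mapping_eqI) (auto simp: lookup_add lookup_minus lookup_single when_def)
      with that False show False by simp
    qed
    with False show ?thesis by (auto simp: lookup_single when_def)
  qed
  show ?thesis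
    unfolding partial_deriv_def lookup_sum summand
    by (auto simp: in_keys_iff)
qed

text \<open>
  The sums count how often \<open>a\<close> occurs in the pair, which is its exponent in a product of two
  variables. These exponents determine the pair as a multiset, and sorting makes it unique.
\<close>

lemma unordered_pair_eq:
  fixes i j i' j' :: "'a :: linorder"
  assumes "i \<le> j" "i' \<le> j'"
    and "\<And>a. of_bool (i = a) + of_bool (j = a) = (of_bool (i' = a) + of_bool (j' = a) :: nat)"
  shows "i = i' \<and> j = j'"
proof -
  have "a \<in> {i, j} \<longleftrightarrow> a \<in> {i', j'}" for a
    using assms(3)[of a] by (simp add: of_bool_def split: if_splits)
  then have "{i, j} = {i', j'}" by blast
  with assms(1,2) show ?thesis
    by (auto simp: doubleton_eq_iff)
qed

definition biquad_monom :: "'n \<Rightarrow> 'n \<Rightarrow> 'm \<Rightarrow> 'm \<Rightarrow> ('n + 'm) \<Rightarrow>\<^sub>0 nat" where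
  "biquad_monom i j k l = Poly_Mapping.single (Inl i) 1 + Poly_Mapping.single (Inl j) 1 +
     Poly_Mapping.single (Inr k) 1 + Poly_Mapping.single (Inr l) 1"

lemma biquad_monom_inject:
  fixes i j i' j' :: "'n :: linorder" and k l k' l' :: "'m :: linorder"
  assumes "i \<le> j" "k \<le> l" "i' \<le> j'" "k' \<le> l'"
  shows "biquad_monom i j k l = biquad_monom i' j' k' l' \<longleftrightarrow> i = i' \<and> j = j' \<and> k = k' \<and> l = l'"
proof
  assume eq: "biquad_monom i j k l = biquad_monom i' j' k' l'"
  have "i = i' \<and> j = j'"
  proof (rule unordered_pair_eq[OF assms(1,3)])
    fix a show "of_bool (i = a) + of_bool (j = a) = (of_bool (i' = a) + of_bool (j' = a) :: nat)"
      using arg_cong[OF eq, of "\<lambda>m. Poly_Mapping.lookup m (Inl a)"]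
      by (simp add: biquad_monom_def lookup_add lookup_single when_def of_bool_def split: if_splits)
  qed
  moreover have "k = k' \<and> l = l'"
  proof (rule unordered_pair_eq[OF assms(2,4)])
    fix a show "of_bool (k = a) + of_bool (l = a) = (of_bool (k' = a) + of_bool (l' = a) :: nat)"
      using arg_cong[OF eq, of "\<lambda>m. Poly_Mapping.lookup m (Inr a)"]
      by (simp add: biquad_monom_def lookup_add lookup_single when_def of_bool_def split: if_splits)
  qed
  ultimately show "i = i' \<and> j = j' \<and> k = k' \<and> l = l'" by simp
qed simp

definition biquad_poly ::
    "('n :: {finite, linorder} \<Rightarrow> 'n \<Rightarrow> 'm :: {finite, linorder} \<Rightarrow> 'm \<Rightarrow> real) \<Rightarrow> ('n + 'm) rpoly" where
  "biquad_poly \<alpha> = (\<Sum>(i, j) \<in> {(i, j). i \<le> j}. \<Sum>(k, l) \<in> {(k, l). k \<le> l}.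
               Const (\<alpha> i j k l) * X i * X j * Y k * Y l)"

text \<open>
  Restricting to sorted index pairs makes the monomials of the sum pairwise distinct, so no
  coefficients are merged.
\<close>

lemma lookup_biquad_poly:
  assumes "i \<le> j" "k \<le> l"
  shows "Poly_Mapping.lookup (biquad_poly \<alpha>) (biquad_monom i j k l) = \<alpha> i j k l"
proof -
  have summand: "Const (\<alpha> i' j' k' l') * X i' * X j' * Y k' * Y l' =
      Poly_Mapping.single (biquad_monom i' j' k' l') (\<alpha> i' j' k' l')" for i' j' k' l'
    by (simp add: Const_def Var_def mult_single biquad_monom_def)
  have "Poly_Mapping.lookup (biquad_poly \<alpha>) (biquad_monom i j k l) =
      (\<Sum>(i', j') \<in> {(i, j). i \<le> j}. \<Sum>(k', l') \<in> {(k, l). k \<le> l}.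
        if (i', j') = (i, j) \<and> (k', l') = (k, l) then \<alpha> i j k l else 0)"
    unfolding biquad_poly_def summand lookup_sum case_prod_unfold
    using assms by (intro sum.cong refl) (auto simp: lookup_single when_def biquad_monom_inject)
  also have "\<dots> = (\<Sum>p \<in> {(i, j). i \<le> j}. if p = (i, j) then
       (\<Sum>q \<in> {(k, l). k \<le> l}. if q = (k, l) then \<alpha> i j k l else 0) else 0)"
    unfolding case_prod_unfold by (intro sum.cong refl) (auto simp: prod_eq_iff)
  also have "\<dots> = \<alpha> i j k l"
    using assms by simp
  finally show ?thesis .
qed

lemma finite_abs_coeffs:
  fixes C :: "('v rpoly) ^ 'm ^ 'n"
  shows "finite {\<bar>Poly_Mapping.lookup (C $ i $ j) m\<bar> | i j m. m \<in> Poly_Mapping.keys (C $ i $ j)}"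
proof -
  have "{\<bar>Poly_Mapping.lookup (C $ i $ j) m\<bar> | i j m. m \<in> Poly_Mapping.keys (C $ i $ j)} =
      (\<Union>i. \<Union>j. (\<lambda>m. \<bar>Poly_Mapping.lookup (C $ i $ j) m\<bar>) ` Poly_Mapping.keys (C $ i $ j))"
    by auto
  then show ?thesis by simp
qed

text \<open>
  For \<open>C \<noteq> 0\<close> the set of coefficients is nonempty, as needed for its maximum to be meaningful.
\<close>

lemma max_abs_coeff_nonneg: "0 \<le> max_abs_coeff (C :: ('v rpoly) ^ 'm ^ 'n)"
proof (cases "C = 0")
  case False
  then obtain i j where "C $ i $ j \<noteq> 0" by (auto simp: vec_eq_iff)
  then obtain m where "m \<in> Poly_Mapping.keys (C $ i $ j)" by (meson all_not_in_conv keys_eq_empty)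
  then have "\<bar>Poly_Mapping.lookup (C $ i $ j) m\<bar> \<le> max_abs_coeff C"
    unfolding max_abs_coeff_def using False finite_abs_coeffs[of C] by (auto intro!: Max_ge)
  then show ?thesis by linarith
qed (simp add: max_abs_coeff_def)

lemma abs_coeff_le_max_abs_coeff:
  fixes C :: "('v rpoly) ^ 'm ^ 'n"
  shows "\<bar>Poly_Mapping.lookup (C $ i $ j) m\<bar> \<le> max_abs_coeff C"
proof (cases "m \<in> Poly_Mapping.keys (C $ i $ j)")
  case True
  then have "C \<noteq> 0" by auto
  with True finite_abs_coeffs[of C] show ?thesis
    unfolding max_abs_coeff_def by (auto intro!: Max_ge)
qed (simp add: in_keys_iff max_abs_coeff_nonneg)

text \<open>
  The factor \<open>2\<close> for \<open>i = j\<close> arises because \<open>x\<^sub>i\<^sup>2\<close> is differentiated; for \<open>i \<noteq> j\<close> the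
  variable \<open>x\<^sub>i\<close> occurs to the first power. The factor for \<open>k = l\<close> has the same origin. They are
  kept in the bound because \<open>biquad_cross_bound\<close> needs them: without them, the diagonal terms
  would cost an additional constant.
\<close>

lemma mixed_hessian_coeff_bound:
  assumes "i \<le> j" "k \<le> l"
  shows "\<bar>\<alpha> i j k l\<bar> * ((if i = j then 2 else 1) * (if k = l then 2 else 1))
     \<le> max_abs_coeff (mixed_hessian (biquad_poly \<alpha>))"
proof -
  let ?m = "Poly_Mapping.single (Inl j) 1 + Poly_Mapping.single (Inr l) (1 :: nat)"
  have "Poly_Mapping.lookup (mixed_hessian (biquad_poly \<alpha>) $ i $ k) ?m =
     Poly_Mapping.lookup (biquad_poly \<alpha>) (biquad_monom i j k l) *
       ((if i = j then 2 else 1) * (if k = l then 2 else 1))"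
    by (simp add: mixed_hessian_def lookup_partial_deriv biquad_monom_def add_ac
        lookup_add lookup_single when_def)
  then show ?thesis
    using abs_coeff_le_max_abs_coeff[of "mixed_hessian (biquad_poly \<alpha>)" i k ?m]
    by (simp add: lookup_biquad_poly assms abs_mult split: if_splits)
qed

section \<open>Estimates on the second derivative\<close>

text \<open>
  A symmetrised sum over sorted pairs covers the full square: off the diagonal each unordered
  pair stands for two ordered ones, on the diagonal for one.
\<close>

lemma sum_ordered_pairs:
  fixes h :: "'a :: {finite, linorder} \<Rightarrow> 'a \<Rightarrow> real"
  shows "(\<Sum>(i, j) \<in> {(i, j). i \<le> j}. if i = j then h i i else h i j + h j i) =
         (\<Sum>i\<in>UNIV. \<Sum>j\<in>UNIV. h i j)"
proof -
  let ?L = "{(i, j :: 'a). i < j}" and ?D = "range (\<lambda>i :: 'a. (i, i))"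
  have split: "{(i, j :: 'a). i \<le> j} = ?D \<union> ?L" by auto
  have diag: "(\<Sum>(i, j) \<in> ?D. h i j) = (\<Sum>i\<in>UNIV. h i i)"
    by (subst sum.reindex) (auto simp: inj_on_def)
  have flip: "(\<Sum>(i, j) \<in> ?L. h j i) = (\<Sum>(i, j) \<in> {(i, j). j < i}. h i j)"
    by (rule sum.reindex_bij_witness[where i = prod.swap and j = prod.swap]) auto
  have "(\<Sum>(i, j) \<in> {(i, j). i \<le> j}. if i = j then h i i else h i j + h j i) =
      (\<Sum>(i, j) \<in> ?D. if i = j then h i i else h i j + h j i) +
      (\<Sum>(i, j) \<in> ?L. if i = j then h i i else h i j + h j i)"
    unfolding split by (rule sum.union_disjoint) auto
  also have "(\<Sum>(i, j) \<in> ?D. if i = j then h i i else h i j + h j i) = (\<Sum>(i, j) \<in> ?D. h i j)"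
    by (rule sum.cong) auto
  also have "(\<Sum>(i, j) \<in> ?L. if i = j then h i i else h i j + h j i) =
      (\<Sum>(i, j) \<in> ?L. h i j) + (\<Sum>(i, j) \<in> ?L. h j i)"
    unfolding sum.distrib[symmetric] by (rule sum.cong) auto
  also have "(\<Sum>(i, j) \<in> ?D. h i j) + ((\<Sum>(i, j) \<in> ?L. h i j) + (\<Sum>(i, j) \<in> ?L. h j i)) =
      (\<Sum>(i, j) \<in> ?D \<union> (?L \<union> {(i, j). j < i}). h i j)"
    unfolding flip by (subst sum.union_disjoint; (subst sum.union_disjoint)?) auto
  also have "?D \<union> (?L \<union> {(i, j). j < i}) = UNIV \<times> UNIV" by (auto simp: not_less_iff_gr_or_eq)
  also have "(\<Sum>(i, j) \<in> UNIV \<times> UNIV. h i j) = (\<Sum>i\<in>UNIV. \<Sum>j\<in>UNIV. h i j)"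
    by (rule sum.cartesian_product[symmetric])
  finally show ?thesis .
qed

definition biquad :: "('n :: {finite, linorder} \<Rightarrow> 'n \<Rightarrow> 'm :: {finite, linorder} \<Rightarrow> 'm \<Rightarrow> real) \<Rightarrow>
    real ^ ('n :: {finite, linorder}) \<Rightarrow> real ^ ('m :: {finite, linorder}) \<Rightarrow> real" where
  "biquad \<alpha> x y = (\<Sum>(i, j) \<in> {(i, j). i \<le> j}. \<Sum>(k, l) \<in> {(k, l). k \<le> l}.
       \<alpha> i j k l * x $ i * x $ j * y $ k * y $ l)"

text \<open>
  This is \<open>u\<^sup>T C(x,y) v\<close>, the mixed part of the Hessian of \<open>biquad \<alpha>\<close>, but indexed by the
  sorted pairs of the coefficients of the form instead of by the entries of \<open>C\<close>.
\<close>

definition biquad_cross :: "('n :: {finite, linorder} \<Rightarrow> 'n \<Rightarrow> 'm :: {finite, linorder} \<Rightarrow> 'm \<Rightarrow> real) \<Rightarrow>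
    real ^ ('n :: {finite, linorder}) \<Rightarrow> real ^ ('n :: {finite, linorder}) \<Rightarrow>
    real ^ ('m :: {finite, linorder}) \<Rightarrow> real ^ ('m :: {finite, linorder}) \<Rightarrow> real" where
  "biquad_cross \<alpha> x u y v = (\<Sum>(i, j) \<in> {(i, j). i \<le> j}. \<Sum>(k, l) \<in> {(k, l). k \<le> l}.
       \<alpha> i j k l * (u $ i * x $ j + x $ i * u $ j) * (v $ k * y $ l + y $ k * v $ l))"

definition quartic :: "real ^ 'n \<Rightarrow> real" where
  "quartic x = ((\<Sum>i\<in>UNIV. (x $ i) ^ 4) + (\<Sum>i\<in>UNIV. (x $ i)\<^sup>2)\<^sup>2) / 2"

lemma eval_biquad_poly: "eval_xy (biquad_poly \<alpha>) x y = biquad \<alpha> x y"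
  by (simp add: eval_xy_def biquad_poly_def biquad_def eval_rpoly_hom case_prod_unfold)

text \<open>
  Expanding the square of \<open>|x|\<^sup>2\<close> counts every off-diagonal product twice, hence the
  halves in \<open>quartic\<close>. In that form there are no sums over pairs left to differentiate.
\<close>

lemma quartic_eq:
  fixes x :: "real ^ 'n :: {finite, linorder}"
  shows "(\<Sum>i\<in>UNIV. (x $ i) ^ 4) + (\<Sum>(i, j) \<in> {(i, j). i < j}. (x $ i)\<^sup>2 * (x $ j)\<^sup>2) = quartic x"
proof -
  let ?L = "{(i, j :: 'n). i < j}" and ?D = "range (\<lambda>i :: 'n. (i, i))"
  have split: "{(i, j :: 'n). i \<le> j} = ?D \<union> ?L" by auto
  have "(\<Sum>i\<in>UNIV. (x $ i)\<^sup>2)\<^sup>2 = (\<Sum>i\<in>UNIV. \<Sum>j\<in>UNIV. (x $ i)\<^sup>2 * (x $ j)\<^sup>2)"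
    by (simp add: power2_eq_square sum_product)
  also have "\<dots> = (\<Sum>(i, j) \<in> ?D \<union> ?L. if i = j then (x $ i)\<^sup>2 * (x $ i)\<^sup>2
      else (x $ i)\<^sup>2 * (x $ j)\<^sup>2 + (x $ j)\<^sup>2 * (x $ i)\<^sup>2)"
    unfolding split[symmetric] by (rule sum_ordered_pairs[symmetric])
  also have "\<dots> = (\<Sum>(i, j) \<in> ?D. (x $ i) ^ 4) + (\<Sum>(i, j) \<in> ?L. 2 * ((x $ i)\<^sup>2 * (x $ j)\<^sup>2))"
    by (subst sum.union_disjoint) (auto intro!: arg_cong2[where f = "(+)"] sum.cong)
  also have "(\<Sum>(i, j) \<in> ?D. (x $ i) ^ 4) = (\<Sum>i\<in>UNIV. (x $ i) ^ 4)"
    by (subst sum.reindex) (auto simp: inj_on_def)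
  finally show ?thesis
    by (simp add: quartic_def sum_distrib_left case_prod_unfold field_simps)
qed

text \<open>
  On the diagonal \<open>u\<^sub>i x\<^sub>j + x\<^sub>i u\<^sub>j\<close> is \<open>2 u\<^sub>i x\<^sub>i\<close>. The weight leaves out this factor \<open>2\<close>:
  the estimate charges it to the coefficient of the form, where it is part of a coefficient of the
  mixed Hessian, and the weights then add up exactly to a product of two \<open>\<ell>\<^sub>1\<close>-norms.
\<close>

definition pair_weight :: "real ^ 'n \<Rightarrow> real ^ 'n \<Rightarrow> 'n \<Rightarrow> 'n \<Rightarrow> real" where
  "pair_weight u x i j =
     (if i = j then \<bar>u $ i\<bar> * \<bar>x $ i\<bar> else \<bar>u $ i\<bar> * \<bar>x $ j\<bar> + \<bar>u $ j\<bar> * \<bar>x $ i\<bar>)"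

lemma pair_weight_nonneg: "0 \<le> pair_weight u x i j"
  by (simp add: pair_weight_def)

lemma pair_weight_bound:
  "\<bar>u $ i * x $ j + x $ i * u $ j\<bar> \<le> (if i = j then 2 else 1) * pair_weight u x i j"
  unfolding pair_weight_def abs_mult[symmetric] by (auto simp: mult.commute)

lemma sum_pair_weight:
  fixes u x :: "real ^ ('n :: {finite, linorder})"
  shows "(\<Sum>(i, j) \<in> {(i, j). i \<le> j}. pair_weight u x i j) =
    (\<Sum>i\<in>UNIV. \<bar>u $ i\<bar>) * (\<Sum>i\<in>UNIV. \<bar>x $ i\<bar>)"
  unfolding pair_weight_def sum_product by (rule sum_ordered_pairs)

text \<open>
  The hypothesis bounds the coefficients of the mixed Hessian. Each summand is estimated by
  \<open>\<gamma>\<close> times a product of two weights, and the sum of these products factors.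
\<close>

lemma biquad_cross_bound:
  assumes "\<And>i j k l. i \<le> j \<Longrightarrow> k \<le> l \<Longrightarrow>
     \<bar>\<alpha> i j k l\<bar> * ((if i = j then 2 else 1) * (if k = l then 2 else 1)) \<le> \<gamma>"
  shows "\<bar>biquad_cross \<alpha> x u y v\<bar> \<le> \<gamma> *
     (((\<Sum>i\<in>UNIV. \<bar>u $ i\<bar>) * (\<Sum>i\<in>UNIV. \<bar>x $ i\<bar>)) * ((\<Sum>i\<in>UNIV. \<bar>v $ i\<bar>) * (\<Sum>i\<in>UNIV. \<bar>y $ i\<bar>)))"
proof -
  have summand: "\<bar>\<alpha> i j k l * (u $ i * x $ j + x $ i * u $ j) * (v $ k * y $ l + y $ k * v $ l)\<bar>
      \<le> \<gamma> * (pair_weight u x i j * pair_weight v y k l)" if "i \<le> j" "k \<le> l" for i j k l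
  proof -
    have "\<bar>\<alpha> i j k l * (u $ i * x $ j + x $ i * u $ j) * (v $ k * y $ l + y $ k * v $ l)\<bar>
      \<le> \<bar>\<alpha> i j k l\<bar> * ((if i = j then 2 else 1) * pair_weight u x i j) *
        ((if k = l then 2 else 1) * pair_weight v y k l)"
      unfolding abs_mult[of _ "_ + _"]
      by (intro mult_mono pair_weight_bound mult_nonneg_nonneg pair_weight_nonneg) auto
    also have "\<dots> = (\<bar>\<alpha> i j k l\<bar> * ((if i = j then 2 else 1) * (if k = l then 2 else 1))) *
        (pair_weight u x i j * pair_weight v y k l)" by (simp only: mult_ac)
    also have "\<dots> \<le> \<gamma> * (pair_weight u x i j * pair_weight v y k l)"
      by (intro mult_right_mono assms that mult_nonneg_nonneg pair_weight_nonneg)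
    finally show ?thesis .
  qed
  have "\<bar>biquad_cross \<alpha> x u y v\<bar> \<le> (\<Sum>(i, j) \<in> {(i, j). i \<le> j}. \<Sum>(k, l) \<in> {(k, l). k \<le> l}.
       \<gamma> * (pair_weight u x i j * pair_weight v y k l))"
    unfolding biquad_cross_def case_prod_unfold
    by (intro sum_abs[THEN order_trans] sum_mono) (auto intro!: summand)
  also have "\<dots> = \<gamma> * ((\<Sum>(i, j) \<in> {(i, j). i \<le> j}. pair_weight u x i j) *
      (\<Sum>(k, l) \<in> {(k, l). k \<le> l}. pair_weight v y k l))"
    unfolding case_prod_unfold by (simp only: sum_product) (simp only: sum_distrib_left)
  finally show ?thesis unfolding sum_pair_weight .
qed

text \<open>
  AM-GM is applied to the product of the \<open>\<ell>\<^sub>1\<close>-norms grouped as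
  \<open>(|u|\<^sub>1 |x|\<^sub>1) (|v|\<^sub>1 |y|\<^sub>1)\<close>, so that
  the two squares match the quartic terms in \<open>x\<close> and in \<open>y\<close> separately. Cauchy-Schwarz, used
  twice in each square, then costs the factor \<open>n\<^sup>2\<close>.
\<close>

lemma double_biquad_cross_bound:
  fixes x u y v :: "real ^ 'n :: {finite, linorder}"
  assumes "\<And>i j k l. i \<le> j \<Longrightarrow> k \<le> l \<Longrightarrow>
     \<bar>\<alpha> i j k l\<bar> * ((if i = j then 2 else 1) * (if k = l then 2 else 1)) \<le> \<gamma>"
    and "0 \<le> \<gamma>"
  shows "\<bar>2 * biquad_cross \<alpha> x u y v\<bar> \<le> real CARD('n) ^ 2 * \<gamma> *
     ((\<Sum>i\<in>UNIV. (x $ i)\<^sup>2) * (\<Sum>i\<in>UNIV. (u $ i)\<^sup>2) + (\<Sum>i\<in>UNIV. (y $ i)\<^sup>2) * (\<Sum>i\<in>UNIV. (v $ i)\<^sup>2))"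
proof -
  define p where "p z = (\<Sum>i\<in>UNIV. \<bar>z $ i\<bar>)" for z :: "real ^ ('n :: {finite, linorder})"
  define q where "q z = (\<Sum>i\<in>UNIV. (z $ i)\<^sup>2)" for z :: "real ^ ('n :: {finite, linorder})"
  let ?n = "real CARD('n)"
  have q: "0 \<le> q z" for z by (simp add: q_def sum_nonneg)
  have pq: "(p z)\<^sup>2 \<le> ?n * q z" for z
    unfolding p_def q_def using sum_squared_le_sum_of_squares[of "\<lambda>i. \<bar>z $ i\<bar>" UNIV]
    by (simp add: mult.commute)
  have ppqq: "(p z * p z')\<^sup>2 \<le> ?n\<^sup>2 * (q z' * q z)" for z z'
    unfolding power_mult_distrib using mult_mono[OF pq[of z] pq[of z']] q
    by (simp add: power2_eq_square mult_ac)
  have "\<bar>2 * biquad_cross \<alpha> x u y v\<bar> \<le> \<gamma> * (2 * (p u * p x) * (p v * p y))"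
    using biquad_cross_bound[OF assms(1), of x u y v] by (simp add: p_def abs_mult)
  also have "\<dots> \<le> \<gamma> * ((p u * p x)\<^sup>2 + (p v * p y)\<^sup>2)"
    by (intro mult_left_mono sum_squares_bound assms)
  also have "\<dots> \<le> \<gamma> * (?n\<^sup>2 * (q x * q u) + ?n\<^sup>2 * (q y * q v))"
    by (intro mult_left_mono add_mono ppqq assms)
  finally show ?thesis by (simp add: q_def algebra_simps)
qed

section \<open>Second derivatives along lines\<close>

text \<open>
  The product rule is applied to each summand; differentiating both \<open>x\<close>-factors, both
  \<open>y\<close>-factors, or one of each yields the three groups of terms in the second derivative.
\<close>

lemma biquad_line_derivs:
  obtains g' where
    "\<And>t. ((\<lambda>t. biquad \<alpha> (x + t *\<^sub>R u) (y + t *\<^sub>R v)) has_real_derivative g' t) (at t)"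
    "\<And>t. (g' has_real_derivative
       2 * biquad \<alpha> u (y + t *\<^sub>R v) + 2 * biquad \<alpha> (x + t *\<^sub>R u) v +
       2 * biquad_cross \<alpha> (x + t *\<^sub>R u) u (y + t *\<^sub>R v) v) (at t)"
proof
  let ?g' = "\<lambda>t. \<Sum>p \<in> {(i, j). i \<le> j}. \<Sum>q \<in> {(k, l). k \<le> l}. \<alpha> (fst p) (snd p) (fst q) (snd q) *
      ((u $ fst p * (x $ snd p + t * u $ snd p) + (x $ fst p + t * u $ fst p) * u $ snd p) *
         ((y $ fst q + t * v $ fst q) * (y $ snd q + t * v $ snd q)) +
       ((x $ fst p + t * u $ fst p) * (x $ snd p + t * u $ snd p)) *
         (v $ fst q * (y $ snd q + t * v $ snd q) + (y $ fst q + t * v $ fst q) * v $ snd q))"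
  show "((\<lambda>t. biquad \<alpha> (x + t *\<^sub>R u) (y + t *\<^sub>R v)) has_real_derivative ?g' t) (at t)" for t
    unfolding biquad_def case_prod_unfold
    by (intro DERIV_sum) (auto intro!: derivative_eq_intros simp: algebra_simps)
  have eq: "2 * biquad \<alpha> u (y + t *\<^sub>R v) + 2 * biquad \<alpha> (x + t *\<^sub>R u) v +
       2 * biquad_cross \<alpha> (x + t *\<^sub>R u) u (y + t *\<^sub>R v) v =
     (\<Sum>p \<in> {(i, j). i \<le> j}. \<Sum>q \<in> {(k, l). k \<le> l}. \<alpha> (fst p) (snd p) (fst q) (snd q) *
      (2 * (u $ fst p * u $ snd p * (y + t *\<^sub>R v) $ fst q * (y + t *\<^sub>R v) $ snd q) +
       2 * ((x + t *\<^sub>R u) $ fst p * (x + t *\<^sub>R u) $ snd p * v $ fst q * v $ snd q) +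
       2 * ((u $ fst p * (x + t *\<^sub>R u) $ snd p + (x + t *\<^sub>R u) $ fst p * u $ snd p) *
            (v $ fst q * (y + t *\<^sub>R v) $ snd q + (y + t *\<^sub>R v) $ fst q * v $ snd q))))" for t
    unfolding biquad_def biquad_cross_def case_prod_unfold sum_distrib_left sum.distrib[symmetric]
    by (intro sum.cong refl) (simp only: distrib_left mult_ac)
  show "(?g' has_real_derivative 2 * biquad \<alpha> u (y + t *\<^sub>R v) + 2 * biquad \<alpha> (x + t *\<^sub>R u) v +
       2 * biquad_cross \<alpha> (x + t *\<^sub>R u) u (y + t *\<^sub>R v) v) (at t)" for t
    unfolding eq
    by (intro DERIV_sum) (auto intro!: derivative_eq_intros simp: algebra_simps)
qed

text \<open>
  With \<open>s(t) = |x + tu|\<^sup>2\<close>, the part \<open>s\<^sup>2/2\<close> has second derivative \<open>s'\<^sup>2 + s s''\<close>, where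
  \<open>s'' = 2|u|\<^sup>2\<close>. The claimed bound is \<open>s s''\<close>; the dropped terms \<open>s'\<^sup>2\<close> and
  \<open>6 \<Sum>\<^sub>i (x\<^sub>i + t u\<^sub>i)\<^sup>2 u\<^sub>i\<^sup>2\<close> are nonnegative.
\<close>

lemma quartic_line_derivs:
  fixes x u :: "real ^ 'n"
  obtains g' g'' where
    "\<And>t. ((\<lambda>t. quartic (x + t *\<^sub>R u)) has_real_derivative g' t) (at t)"
    "\<And>t. (g' has_real_derivative g'' t) (at t)"
    "\<And>t. 2 * ((\<Sum>i\<in>UNIV. ((x + t *\<^sub>R u) $ i)\<^sup>2) * (\<Sum>i\<in>UNIV. (u $ i)\<^sup>2)) \<le> g'' t"
proof
  let ?g' = "\<lambda>t. 2 * (\<Sum>i\<in>UNIV. (x $ i + t * u $ i) ^ 3 * u $ i) +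
      2 * ((\<Sum>i\<in>UNIV. (x $ i + t * u $ i)\<^sup>2) * (\<Sum>i\<in>UNIV. (x $ i + t * u $ i) * u $ i))"
  let ?g'' = "\<lambda>t. 6 * (\<Sum>i\<in>UNIV. (x $ i + t * u $ i)\<^sup>2 * (u $ i)\<^sup>2) +
      (4 * (\<Sum>i\<in>UNIV. (x $ i + t * u $ i) * u $ i)\<^sup>2 +
       2 * ((\<Sum>i\<in>UNIV. (x $ i + t * u $ i)\<^sup>2) * (\<Sum>i\<in>UNIV. (u $ i)\<^sup>2)))"
  have d4: "((\<lambda>t. \<Sum>i\<in>UNIV. (x $ i + t * u $ i) ^ 4) has_real_derivative
      4 * (\<Sum>i\<in>UNIV. (x $ i + t * u $ i) ^ 3 * u $ i)) (at t)" for t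
    unfolding sum_distrib_left by (intro DERIV_sum) (auto intro!: derivative_eq_intros)
  have d3: "((\<lambda>t. \<Sum>i\<in>UNIV. (x $ i + t * u $ i) ^ 3 * u $ i) has_real_derivative
      3 * (\<Sum>i\<in>UNIV. (x $ i + t * u $ i)\<^sup>2 * (u $ i)\<^sup>2)) (at t)" for t
    unfolding sum_distrib_left
    by (intro DERIV_sum) (auto intro!: derivative_eq_intros simp: power2_eq_square)
  have d2: "((\<lambda>t. \<Sum>i\<in>UNIV. (x $ i + t * u $ i)\<^sup>2) has_real_derivative
      2 * (\<Sum>i\<in>UNIV. (x $ i + t * u $ i) * u $ i)) (at t)" for t
    unfolding sum_distrib_left by (intro DERIV_sum) (auto intro!: derivative_eq_intros)
  have d1: "((\<lambda>t. \<Sum>i\<in>UNIV. (x $ i + t * u $ i) * u $ i) has_real_derivative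
      (\<Sum>i\<in>UNIV. (u $ i)\<^sup>2)) (at t)" for t
    by (intro DERIV_sum) (auto intro!: derivative_eq_intros simp: power2_eq_square)
  show "((\<lambda>t. quartic (x + t *\<^sub>R u)) has_real_derivative ?g' t) (at t)" for t
    unfolding quartic_def vector_add_component vector_scaleR_component real_scaleR_def
    by (rule DERIV_cong[OF DERIV_cdivide[OF DERIV_add[OF d4 DERIV_power[OF d2]]]]) simp
  show "(?g' has_real_derivative ?g'' t) (at t)" for t
    by (rule DERIV_cong[OF DERIV_add[OF DERIV_cmult[OF d3] DERIV_cmult[OF DERIV_mult[OF d2 d1]]]])
       (simp add: power2_eq_square algebra_simps)
  show "2 * ((\<Sum>i\<in>UNIV. ((x + t *\<^sub>R u) $ i)\<^sup>2) * (\<Sum>i\<in>UNIV. (u $ i)\<^sup>2)) \<le> ?g'' t" for t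
    by (simp add: sum_nonneg)
qed

lemma convex_on_UNIV_of_lines:
  fixes F :: "'a :: real_vector \<Rightarrow> real"
  assumes "\<And>p d. convex_on UNIV (\<lambda>t. F (p + t *\<^sub>R d))"
  shows "convex_on UNIV F"
proof (rule convex_onI)
  fix t :: real and p q :: 'a
  assume t: "0 < t" "t < 1"
  have "F (p + ((1 - t) *\<^sub>R 0 + t *\<^sub>R 1) *\<^sub>R (q - p)) \<le>
      (1 - t) * F (p + 0 *\<^sub>R (q - p)) + t * F (p + 1 *\<^sub>R (q - p))"
    by (rule convex_onD[OF assms]) (use t in auto)
  then show "F ((1 - t) *\<^sub>R p + t *\<^sub>R q) \<le> (1 - t) * F p + t * F q"
    by (simp add: algebra_simps)
qed simp

section \<open>Nonnegativity and convexity\<close>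

text \<open>
  In the second derivative along a line, the values of the form are nonnegative by hypothesis, and
  the cross term is bounded by exactly what the quartic part guarantees.
\<close>

lemma biquad_nonneg_imp_convex:
  fixes \<alpha> :: "'n :: {finite, linorder} \<Rightarrow> 'n \<Rightarrow> 'n \<Rightarrow> 'n \<Rightarrow> real"
  assumes nonneg: "\<And>x y. 0 \<le> biquad \<alpha> x y"
    and bound: "\<And>i j k l. i \<le> j \<Longrightarrow> k \<le> l \<Longrightarrow>
     \<bar>\<alpha> i j k l\<bar> * ((if i = j then 2 else 1) * (if k = l then 2 else 1)) \<le> \<gamma>"
    and "0 \<le> \<gamma>"
  shows "convex_on UNIV
     (\<lambda>(x, y). biquad \<alpha> x y + real CARD('n) ^ 2 * \<gamma> / 2 * (quartic x + quartic y))"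
proof (rule convex_on_UNIV_of_lines)
  fix p d :: "(real ^ ('n :: {finite, linorder})) \<times> (real ^ ('n :: {finite, linorder}))"
  obtain x y u v where p: "p = (x, y)" and d: "d = (u, v)" by fastforce
  let ?K = "real CARD('n) ^ 2 * \<gamma> / 2"
  obtain b' where b':
    "\<And>t. ((\<lambda>t. biquad \<alpha> (x + t *\<^sub>R u) (y + t *\<^sub>R v)) has_real_derivative b' t) (at t)"
    "\<And>t. (b' has_real_derivative
       2 * biquad \<alpha> u (y + t *\<^sub>R v) + 2 * biquad \<alpha> (x + t *\<^sub>R u) v +
       2 * biquad_cross \<alpha> (x + t *\<^sub>R u) u (y + t *\<^sub>R v) v) (at t)"
    using biquad_line_derivs[of \<alpha> x u y v] by blast
  obtain q' q'' where q:
    "\<And>t. ((\<lambda>t. quartic (x + t *\<^sub>R u)) has_real_derivative q' t) (at t)"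
    "\<And>t. (q' has_real_derivative q'' t) (at t)"
    "\<And>t. 2 * ((\<Sum>i\<in>UNIV. ((x + t *\<^sub>R u) $ i)\<^sup>2) * (\<Sum>i\<in>UNIV. (u $ i)\<^sup>2)) \<le> q'' t"
    using quartic_line_derivs[of x u] by blast
  obtain r' r'' where r:
    "\<And>t. ((\<lambda>t. quartic (y + t *\<^sub>R v)) has_real_derivative r' t) (at t)"
    "\<And>t. (r' has_real_derivative r'' t) (at t)"
    "\<And>t. 2 * ((\<Sum>i\<in>UNIV. ((y + t *\<^sub>R v) $ i)\<^sup>2) * (\<Sum>i\<in>UNIV. (v $ i)\<^sup>2)) \<le> r'' t"
    using quartic_line_derivs[of y v] by blast
  have "convex_on UNIV (\<lambda>t. biquad \<alpha> (x + t *\<^sub>R u) (y + t *\<^sub>R v) +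
      ?K * (quartic (x + t *\<^sub>R u) + quartic (y + t *\<^sub>R v)))"
  proof (rule f''_ge0_imp_convex)
    show "((\<lambda>t. biquad \<alpha> (x + t *\<^sub>R u) (y + t *\<^sub>R v) +
        ?K * (quartic (x + t *\<^sub>R u) + quartic (y + t *\<^sub>R v))) has_real_derivative
        b' t + ?K * (q' t + r' t)) (at t)" for t
      by (intro DERIV_add DERIV_cmult b' q r)
    show "((\<lambda>t. b' t + ?K * (q' t + r' t)) has_real_derivative
        (2 * biquad \<alpha> u (y + t *\<^sub>R v) + 2 * biquad \<alpha> (x + t *\<^sub>R u) v +
         2 * biquad_cross \<alpha> (x + t *\<^sub>R u) u (y + t *\<^sub>R v) v) + ?K * (q'' t + r'' t)) (at t)" for t
      by (intro DERIV_add DERIV_cmult b' q r)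
    show "0 \<le> (2 * biquad \<alpha> u (y + t *\<^sub>R v) + 2 * biquad \<alpha> (x + t *\<^sub>R u) v +
         2 * biquad_cross \<alpha> (x + t *\<^sub>R u) u (y + t *\<^sub>R v) v) + ?K * (q'' t + r'' t)" for t
    proof -
      have K: "?K * (2 * a + 2 * c) = real CARD('n) ^ 2 * \<gamma> * (a + c)" for a c
        by (simp add: field_simps)
      have "?K * (2 * ((\<Sum>i\<in>UNIV. ((x + t *\<^sub>R u) $ i)\<^sup>2) * (\<Sum>i\<in>UNIV. (u $ i)\<^sup>2)) +
                  2 * ((\<Sum>i\<in>UNIV. ((y + t *\<^sub>R v) $ i)\<^sup>2) * (\<Sum>i\<in>UNIV. (v $ i)\<^sup>2)))
          \<le> ?K * (q'' t + r'' t)"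
        using \<open>0 \<le> \<gamma>\<close> by (intro mult_left_mono add_mono q r) simp
      moreover have "\<bar>2 * biquad_cross \<alpha> (x + t *\<^sub>R u) u (y + t *\<^sub>R v) v\<bar> \<le>
          ?K * (2 * ((\<Sum>i\<in>UNIV. ((x + t *\<^sub>R u) $ i)\<^sup>2) * (\<Sum>i\<in>UNIV. (u $ i)\<^sup>2)) +
                2 * ((\<Sum>i\<in>UNIV. ((y + t *\<^sub>R v) $ i)\<^sup>2) * (\<Sum>i\<in>UNIV. (v $ i)\<^sup>2)))"
        using double_biquad_cross_bound[OF bound \<open>0 \<le> \<gamma>\<close>, of "x + t *\<^sub>R u" u "y + t *\<^sub>R v" v]
        unfolding K .
      ultimately show ?thesis
        using nonneg[of u "y + t *\<^sub>R v"] nonneg[of "x + t *\<^sub>R u" v] by linarith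
    qed
  qed simp
  then show "convex_on UNIV (\<lambda>t. (\<lambda>(x, y). biquad \<alpha> x y + ?K * (quartic x + quartic y)) (p + t *\<^sub>R d))"
    by (simp add: p d)
qed

lemma biquad_scale: "biquad \<alpha> x (t *\<^sub>R y) = t\<^sup>2 * biquad \<alpha> x y"
  by (simp add: biquad_def case_prod_unfold sum_distrib_left power2_eq_square mult_ac)

lemma quartic_scale: "quartic (t *\<^sub>R x) = t ^ 4 * quartic x"
  by (simp add: quartic_def power_mult_distrib sum_distrib_left[symmetric] distrib_left)

text \<open>
  The point \<open>(x, 0)\<close> is the midpoint of \<open>(x, ty)\<close> and \<open>(x, -ty)\<close>, and the term \<open>K q(x)\<close> has the
  same value at all three, so it cancels from the inequality.
\<close>

lemma convex_imp_biquad_nonneg: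
  assumes "convex_on UNIV (\<lambda>(x, y). biquad \<alpha> x y + K * (quartic x + quartic y))"
  shows "0 \<le> biquad \<alpha> x y"
proof -
  define B where "B = biquad \<alpha> x y"
  define c where "c = K * quartic y"
  have pos: "0 \<le> B + t\<^sup>2 * c" if "0 < t" for t :: real
  proof -
    have "(1 - 1 / 2) *\<^sub>R (x, t *\<^sub>R y) + (1 / 2) *\<^sub>R (x, (- t) *\<^sub>R y) = (x, 0 *\<^sub>R y)"
      by (simp add: scaleR_left_distrib[symmetric])
    then have "0 \<le> t\<^sup>2 * (B + t\<^sup>2 * c)"
      using convex_onD[OF assms, of "1 / 2" "(x, t *\<^sub>R y)" "(x, (- t) *\<^sub>R y)"]
      by (simp only: case_prod_conv biquad_scale quartic_scale)
         (simp add: B_def c_def algebra_simps power4_eq_xxxx power2_eq_square)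
    with that show ?thesis by (simp add: zero_le_mult_iff)
  qed
  have "((\<lambda>t. B + t\<^sup>2 * c) \<longlongrightarrow> B + 0\<^sup>2 * c) (at_right 0)"
    by (intro tendsto_intros)
  then have "0 \<le> B + 0\<^sup>2 * c"
    by (rule tendsto_lowerbound) (auto intro: eventually_mono[OF eventually_at_right_less] pos)
  then show ?thesis by (simp add: B_def)
qed

theorem theorem2p3:
  fixes b f :: "('n :: {finite, linorder} + 'n) rpoly"
    and C :: "(('n :: {finite, linorder}) + 'n) rpoly ^ ('n :: {finite, linorder}) ^ ('n :: {finite, linorder})"
    and \<gamma> :: real
  assumes "biquadratic_form b"
    and "C = mixed_hessian b"
    and "\<gamma> = max_abs_coeff C"
    and "f = b + Const (real (CARD('n)) ^ 2 * \<gamma> / 2) *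
               ((\<Sum>i\<in>UNIV. X i ^ 4) + (\<Sum>i\<in>UNIV. Y i ^ 4)
                + (\<Sum>(i, j) \<in> {(i, j). i < j}. X i ^ 2 * X j ^ 2)
                + (\<Sum>(i, j) \<in> {(i, j). i < j}. Y i ^ 2 * Y j ^ 2))"
  shows "(\<forall>x y. 0 \<le> eval_xy b x y) \<longleftrightarrow>
         convex_on (UNIV :: ((real ^ ('n :: {finite, linorder})) \<times> (real ^ ('n :: {finite, linorder}))) set)
           (\<lambda>(x, y). eval_xy f x y)"
proof -
  obtain \<alpha> where b: "b = biquad_poly \<alpha>"
    using assms(1) unfolding biquadratic_form_def biquad_poly_def by blast
  have eval_b: "eval_xy b x y = biquad \<alpha> x y" for x y
    unfolding b by (rule eval_biquad_poly)
  have eval_f: "eval_xy f x y =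
      biquad \<alpha> x y + real CARD('n) ^ 2 * \<gamma> / 2 * (quartic x + quartic y)" for x y
    unfolding assms(4) eval_b[symmetric] quartic_eq[symmetric]
    by (simp add: eval_xy_def eval_rpoly_hom case_prod_unfold algebra_simps)
  have bound: "\<bar>\<alpha> i j k l\<bar> * ((if i = j then 2 else 1) * (if k = l then 2 else 1)) \<le> \<gamma>"
    if "i \<le> j" "k \<le> l" for i j k l
    unfolding assms(2,3) b using that by (rule mixed_hessian_coeff_bound)
  have "0 \<le> \<gamma>" unfolding assms(3) by (rule max_abs_coeff_nonneg)
  show ?thesis
    unfolding eval_b eval_f
    using biquad_nonneg_imp_convex[OF _ bound \<open>0 \<le> \<gamma>\<close>] convex_imp_biquad_nonneg by blast
qed

end
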